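(* Let $T_*\in\mathcal T(s)$ with $1\le s\le K$, and assume $\kappa(A_{\underline J},s)>0$. Then for any $\epsilon\ge 0$, with probability at least $1-2p^{-1}-2\epsilon$, $$\|\widehat T_{\rm mle}-T_*\|_1\ \le\ \frac{2}{\kappa^2(A_{\underline J},s)}\left\{\sqrt{\frac{2\rho\log(K/\epsilon)}{N}}+\frac{2\rho\log(K/\epsilon)}{N}\right\}$$ (the right-hand side being $+\infty$ when $\epsilon=0$).
   Context: Setting. $p>K\ge1$ and $N\ge 1$ are integers, $\Delta_d=\{x\in\mathbb R^d: x_j\ge 0\ \forall j,\ \sum_j x_j=1\}$. $A\in\mathbb R^{p\times K}$ is a known matrix whose columns belong to $\Delta_p$; $A_{j\cdot}\in\mathbb R^K$ denotes its $j$-th row (as a column vector) and, for $U\subseteq[p]$, $A_U$ denotes the submatrix of rows in $U$. $T_*\in\Delta_K$, $\Pi_*=AT_*\in\Delta_p$, and the data $X\in\mathbb R^p$ satisfies $NX\sim\mathrm{Multinomial}_p(N;\Pi_* )$. $S_*=\mathrm{supp}(T_* )$ and $\mathcal T(s)=\{T\in\Delta_K:|\mathrm{supp}(T)|=s\}$. Estimator. $J=\{j\in[p]:X_j>0\}$ and $\widehat T_{\rm mle}\in\arg\max_{T\in\Delta_K}\sum_{j\in J}X_j\log(A_{j\cdot}^\top T)$. Quantities. $\overline J=\{j:\Pi_{*j}>0\}$; $\varepsilon_j=2\sqrt{\Pi_{*j}\log p/N}+\frac{4\log p}{3N}$; $\underline J=\{j:\Pi_{*j}>2\varepsilon_j\}$;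 $\rho=\max_{j\in\overline J}\|A_{j\cdot}\|_\infty/\Pi_{*j}$. For a matrix $M$ with $K$ columns, $$\kappa(M,s)=\min_{S\subseteq[K],\,|S|\le s}\ \min_{v\in\mathcal C(S)}\frac{\|Mv\|_1}{\|v\|_1},\qquad \mathcal C(S)=\{v\in\mathbb R^K\setminus\{0\}:\|v_S\|_1\ge\|v_{S^c}\|_1\}.$$ *)

theory Defs
  imports "HOL-Probability.Probability"
begin

unbundle vec_syntax

definition prob_simplex :: "(real ^ 'n) set" where
  "prob_simplex = {x. (\<forall>j. 0 \<le> x $ j) \<and> (\<Sum>j\<in>UNIV. x $ j) = 1}"

definition supp :: "real ^ 'n \<Rightarrow> 'n set" where
  "supp x = {j. x $ j \<noteq> 0}"

definition sparse_simplex :: "nat \<Rightarrow> (real ^ 'n) set" where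
  "sparse_simplex s = {T \<in> prob_simplex. card (supp T) = s}"

definition l1norm :: "real ^ 'n \<Rightarrow> real" where
  "l1norm x = (\<Sum>j\<in>UNIV. \<bar>x $ j\<bar>)"


definition categorical_pmf :: "real ^ 'p \<Rightarrow> 'p pmf" where
  "categorical_pmf q = embed_pmf (\<lambda>j. q $ j)"

text \<open>
  The cell counts of \<open>N\<close> independent draws from the categorical distribution \<open>q\<close>; the usual
  mass function is derived in \<open>pmf_multinomial\<close> below.
\<close>

definition multinomial_pmf :: "nat \<Rightarrow> real ^ 'p \<Rightarrow> ('p \<Rightarrow> nat) pmf" where
  "multinomial_pmf N q =
     map_pmf (\<lambda>f j. card {i. i < N \<and> f i = j}) (Pi_pmf {..<N} undefined (\<lambda>_. categorical_pmf q))"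

definition multinomial :: "nat \<Rightarrow> real ^ 'p \<Rightarrow> (real ^ 'p) measure" where
  "multinomial N q = distr (measure_pmf (multinomial_pmf N q)) borel (\<lambda>c. \<chi> j. real (c j))"

lemma pmf_categorical:
  assumes "q \<in> prob_simplex"
  shows "pmf (categorical_pmf q) j = q $ j"
  unfolding categorical_pmf_def
proof (rule pmf_embed_pmf)
  show "0 \<le> q $ x" for x
    using assms by (simp add: prob_simplex_def)
  have "(\<integral>\<^sup>+x. ennreal (q $ x) \<partial>count_space UNIV) = (\<Sum>x\<in>UNIV. ennreal (q $ x))"
    by (simp add: nn_integral_count_space_finite)
  also have "\<dots> = ennreal (\<Sum>x\<in>UNIV. q $ x)"
    using assms by (intro sum_ennreal) (simp add: prob_simplex_def)
  finally show "(\<integral>\<^sup>+x. ennreal (q $ x) \<partial>count_space UNIV) = 1"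
    using assms by (simp add: prob_simplex_def)
qed

lemma multinomial_pmf_Suc:
  "multinomial_pmf (Suc N) q =
     bind_pmf (categorical_pmf q) (\<lambda>j. map_pmf (\<lambda>c. c(j := Suc (c j))) (multinomial_pmf N q))"
proof -
  have card: "(\<lambda>k. card {i. i < Suc N \<and> (f(N := j)) i = k}) =
      (\<lambda>k. card {i. i < N \<and> f i = k})(j := Suc (card {i. i < N \<and> f i = j}))"
    for f :: "nat \<Rightarrow> 'a" and j
  proof
    fix k
    have "{i. i < Suc N \<and> (f(N := j)) i = k} =
        (if k = j then insert N {i. i < N \<and> f i = k} else {i. i < N \<and> f i = k})"
      by (auto simp: less_Suc_eq)
    then show "card {i. i < Suc N \<and> (f(N := j)) i = k} =
        ((\<lambda>k. card {i. i < N \<and> f i = k})(j := Suc (card {i. i < N \<and> f i = j}))) k"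
      by (auto split: if_splits)
  qed
  have "Pi_pmf {..<Suc N} undefined (\<lambda>_. categorical_pmf q) =
      bind_pmf (categorical_pmf q) (\<lambda>j. bind_pmf (Pi_pmf {..<N} undefined (\<lambda>_. categorical_pmf q))
        (\<lambda>f. return_pmf (f(N := j))))"
    by (simp add: lessThan_Suc Pi_pmf_insert')
  then show ?thesis
    unfolding multinomial_pmf_def
    by (simp only: map_bind_pmf map_return_pmf card map_pmf_comp) (simp add: map_pmf_def)
qed

lemma pmf_multinomial:
  fixes q :: "real ^ 'p"
  assumes "q \<in> prob_simplex"
  shows "pmf (multinomial_pmf N q) c =
    (if (\<Sum>j\<in>UNIV. c j) = N
     then fact N / (\<Prod>j\<in>UNIV. fact (c j)) * (\<Prod>j\<in>UNIV. (q $ j) ^ c j) else 0)"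
proof (induction N arbitrary: c)
  case 0
  have "multinomial_pmf 0 q = return_pmf (\<lambda>_. 0)"
    by (simp add: multinomial_pmf_def)
  then show ?case
    by (auto simp: pmf_return fun_eq_iff indicator_def)
next
  case (Suc N)
  let ?w = "\<lambda>c. (\<Prod>j\<in>UNIV. (q $ j) ^ c j) / (\<Prod>j\<in>UNIV. fact (c j)) :: real"
  have step: "q $ j * pmf (map_pmf (\<lambda>c. c(j := Suc (c j))) (multinomial_pmf N q)) c =
      (if sum c UNIV = Suc N then fact N * real (c j) * ?w c else 0)" for j
  proof (cases "c j")
    case 0
    then have "c \<notin> (\<lambda>c. c(j := Suc (c j))) ` set_pmf (multinomial_pmf N q)"
      by (metis (no_types, lifting) fun_upd_same imageE nat.distinct(1))
    then have "pmf (map_pmf (\<lambda>c. c(j := Suc (c j))) (multinomial_pmf N q)) c = 0"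
      by (simp add: pmf_eq_0_set_pmf)
    with 0 show ?thesis by simp
  next
    case (Suc m)
    define d where "d = c(j := m)"
    have c: "c = d(j := Suc (d j))"
      using Suc by (auto simp: d_def)
    have inj: "inj (\<lambda>c :: 'p \<Rightarrow> nat. c(j := Suc (c j)))"
    proof (rule injI)
      fix x y :: "'p \<Rightarrow> nat" assume eq: "x(j := Suc (x j)) = y(j := Suc (y j))"
      show "x = y"
      proof
        fix k show "x k = y k"
          using fun_cong[OF eq, of k] by (auto split: if_splits)
      qed
    qed
    have split: "(\<Sum>k\<in>UNIV. f (c k)) = f (c j) + (\<Sum>k\<in>UNIV - {j}. f (d k))" for f :: "nat \<Rightarrow> nat"
      by (subst sum.remove[of _ j]) (auto simp: d_def)
    have split': "(\<Sum>k\<in>UNIV. f (d k)) = f (d j) + (\<Sum>k\<in>UNIV - {j}. f (d k))" for f :: "nat \<Rightarrow> nat"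
      by (subst sum.remove[of _ j]) auto
    have "sum c UNIV = Suc (sum d UNIV)"
      using split[of "\<lambda>x. x"] split'[of "\<lambda>x. x"] Suc by (simp add: d_def)
    moreover have "(\<Prod>k\<in>UNIV. (q $ k) ^ c k) = q $ j * (\<Prod>k\<in>UNIV. (q $ k) ^ d k)"
      by (subst (1 2) prod.remove[of _ j]) (auto simp: c mult.assoc)
    moreover have "(\<Prod>k\<in>UNIV. fact (c k) :: real) = real (c j) * (\<Prod>k\<in>UNIV. fact (d k))"
      by (subst (1 2) prod.remove[of _ j]) (auto simp: c mult.assoc)
    moreover have "real (c j) \<noteq> 0"
      using Suc by simp
    moreover have "pmf (map_pmf (\<lambda>c. c(j := Suc (c j))) (multinomial_pmf N q)) c =
        pmf (multinomial_pmf N q) d"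
      by (subst c) (rule pmf_map_inj'[OF inj])
    ultimately show ?thesis
      by (simp add: Suc.IH)
  qed
  have "pmf (multinomial_pmf (Suc N) q) c =
      (\<Sum>j\<in>UNIV. q $ j * pmf (map_pmf (\<lambda>c. c(j := Suc (c j))) (multinomial_pmf N q)) c)"
    unfolding multinomial_pmf_Suc pmf_bind
    by (subst integral_measure_pmf_real[of UNIV]) (auto simp: pmf_categorical[OF assms] mult.commute)
  also have "\<dots> = (if sum c UNIV = Suc N then fact N * real (sum c UNIV) * ?w c else 0)"
    by (simp only: step of_nat_sum sum_distrib_left sum_distrib_right) simp
  finally show ?case
    by (simp add: algebra_simps)
qed


text \<open>
  HOL's \<^term>\<open>ln (0::real)\<close> is 0, which would reward fitted probabilities that vanish on an
  observed cell; in the likelihood the logarithm of 0 has to be \<open>-\<infinity>\<close>.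
\<close>

definition eln :: "real \<Rightarrow> ereal" where
  "eln x = (if x > 0 then ereal (ln x) else - \<infinity>)"

definition loglik :: "real ^ 'k ^ 'p \<Rightarrow> real ^ 'p \<Rightarrow> real ^ 'k \<Rightarrow> ereal" where
  "loglik A x T = (\<Sum>j\<in>{j. x $ j > 0}. ereal (x $ j) * eln (A $ j \<bullet> T))"

definition is_mle :: "real ^ 'k ^ 'p \<Rightarrow> real ^ 'p \<Rightarrow> real ^ 'k \<Rightarrow> bool" where
  "is_mle A x T \<longleftrightarrow> is_arg_max (loglik A x) (\<lambda>T. T \<in> prob_simplex) T"


definition Jbar :: "real ^ 'p \<Rightarrow> 'p set" where
  "Jbar q = {j. q $ j > 0}"

definition eps_cell :: "nat \<Rightarrow> real ^ 'p \<Rightarrow> 'p \<Rightarrow> real" where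
  "eps_cell N q j = 2 * sqrt (q $ j * ln (real CARD('p)) / real N)
     + 4 * ln (real CARD('p)) / (3 * real N)"

definition Jlow :: "nat \<Rightarrow> real ^ 'p \<Rightarrow> 'p set" where
  "Jlow N q = {j. q $ j > 2 * eps_cell N q j}"

definition rho :: "real ^ 'k ^ 'p \<Rightarrow> real ^ 'p \<Rightarrow> real" where
  "rho A q = Max ((\<lambda>j. infnorm (A $ j) / q $ j) ` Jbar q)"

text \<open>
  The submatrix \<open>A\<^sub>U\<close> is represented by replacing the rows outside \<open>U\<close> by zero rows, which leaves
  every \<open>\<parallel>A\<^sub>U v\<parallel>\<^sub>1\<close> unchanged.
\<close>

definition rows_in :: "real ^ 'k ^ 'p \<Rightarrow> 'p set \<Rightarrow> real ^ 'k ^ 'p" where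
  "rows_in A U = (\<chi> j. if j \<in> U then A $ j else 0)"

definition dominated_cone :: "'k set \<Rightarrow> (real ^ 'k) set" where
  "dominated_cone S = {v. v \<noteq> 0 \<and> (\<Sum>k\<in>S. \<bar>v $ k\<bar>) \<ge> (\<Sum>k\<in>- S. \<bar>v $ k\<bar>)}"

text \<open>
  The two nested minima are taken as one infimum over all admissible pairs \<open>(S, v)\<close>: for \<open>S = {}\<close>
  the cone is empty, and HOL's real-valued infimum of the empty set is not \<open>+\<infinity>\<close>. The set below
  is nonempty as soon as \<open>s \<ge> 1\<close>.
\<close>

definition kappa :: "real ^ 'k ^ 'm \<Rightarrow> nat \<Rightarrow> real" where
  "kappa M s = Inf {l1norm (M *v v) / l1norm v | S v. card S \<le> s \<and> v \<in> dominated_cone S}"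

end

theory Submission
  imports Defs
begin

text \<open>
  Write \<open>q = A T\<^sub>*\<close> for the true cell probabilities, \<open>r = A T\<close> for the ones fitted by the
  maximum likelihood estimate \<open>T\<close>, and \<open>d = r - q = A (T - T\<^sub>*)\<close>. The simplex is convex and \<open>T\<close>
  maximises the likelihood, which therefore cannot increase when one moves from \<open>T\<close> towards \<open>T\<^sub>*\<close>;
  this first-order condition (\<open>mle_score_nonpos\<close>) is \<open>\<Sum>\<^sub>j X\<^sub>j d\<^sub>j / r\<^sub>j \<ge> 0\<close>. Subtracting it from \<open>\<Sum>\<^sub>j X\<^sub>j d\<^sub>j / q\<^sub>j\<close> and splitting
  \<open>X = (X - q) + q\<close> gives the basic inequality
  \<open>\<Sum>\<^sub>j X\<^sub>j d\<^sub>j\<^sup>2 / (q\<^sub>j r\<^sub>j) \<le> \<Sum>\<^sub>j (X\<^sub>j - q\<^sub>j) d\<^sub>j / q\<^sub>j + \<Sum>\<^sub>j d\<^sub>j\<close>, the left sum over the observed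
  cells and the others over the cells with \<open>q\<^sub>j > 0\<close>,
  whose last sum is nonpositive because \<open>q\<close> has mass 1 on its support while \<open>r\<close> has at most that.

  The right-hand side is linear in the error: it is at most \<open>\<parallel>T - T\<^sub>*\<parallel>\<^sub>1\<close> times the largest deviation
  of the \<open>K\<close> weighted counts \<open>\<Sum>\<^sub>j X\<^sub>j A\<^sub>j\<^sub>k / q\<^sub>j\<close> from their means. The left-hand side is quadratic in
  it: where \<open>X\<^sub>j \<ge> q\<^sub>j / 2\<close>, as is likely on every cell of large probability, Cauchy-Schwarz with the
  weights \<open>r\<^sub>j\<close> (of total mass 1) bounds it below by half the square of the \<open>\<ell>\<^sub>1\<close>-norm of \<open>d\<close> over those
  cells, and the definition of \<open>\<kappa>\<close> converts that norm into \<open>\<kappa> \<parallel>T - T\<^sub>*\<parallel>\<^sub>1\<close>, since the difference of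
  two points of the simplex lies in the cone of the support of the second one. Cancelling one
  factor \<open>\<parallel>T - T\<^sub>*\<parallel>\<^sub>1\<close> yields the claim (\<open>mle_l1_error_of_regular_sample\<close>) for every sample that is
  regular: cells of probability 0 are not observed, those of large probability have at least half
  of their expected frequency, and the \<open>K\<close> weighted counts are close to their means.

  What is left is the probability of a regular sample (\<open>multinomial_regular_event\<close>). All the
  statistics involved are sums \<open>\<Sum>\<^sub>j w\<^sub>j c\<^sub>j\<close> of multinomial counts with weights in an interval
  \<open>[0, b]\<close>. The exponential moment of such a sum is an exact \<open>N\<close>-th power, and by convexity of the
  exponential it is dominated by that of \<open>b\<close> times a Poisson variable of the same mean
  (\<open>multinomial_chernoff\<close>). Poisson tails then give the deviation of every weighted count, with
  \<open>b = \<rho>\<close>, as well as the halving bound \<open>P(X\<^sub>j \<le> q\<^sub>j / 2) \<le> exp (- N q\<^sub>j / 8)\<close>, and a union bound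
  over the \<open>K\<close> columns and at most \<open>p\<close> cells concludes.
\<close>

section \<open>Tail bounds for weighted multinomial counts\<close>

lemma multinomial_exp_moment:
  fixes q :: "real ^ 'p"
  assumes "q \<in> prob_simplex"
  shows "(\<integral>\<^sup>+ c. ennreal (exp (\<Sum>j\<in>UNIV. w j * real (c j))) \<partial>multinomial_pmf N q) =
    ennreal ((\<Sum>j\<in>UNIV. q $ j * exp (w j)) ^ N)"
proof (induction N)
  case 0
  have "multinomial_pmf 0 q = return_pmf (\<lambda>_. 0)"
    by (simp add: multinomial_pmf_def)
  then show ?case by simp
next
  case (Suc N)
  let ?L = "\<Sum>j\<in>UNIV. q $ j * exp (w j)"
  have q0: "q $ j \<ge> 0" for j
    using assms by (simp add: prob_simplex_def)
  have shift: "(\<Sum>k\<in>UNIV. w k * real ((c(j := Suc (c j))) k)) = w j + (\<Sum>k\<in>UNIV. w k * real (c k))"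
    for c j
    by (subst (1 2) sum.remove[of UNIV j]) (auto simp: algebra_simps)
  have one: "(\<integral>\<^sup>+ c. ennreal (exp (\<Sum>k\<in>UNIV. w k * real (c k)))
        \<partial>map_pmf (\<lambda>c. c(j := Suc (c j))) (multinomial_pmf N q)) =
      ennreal (exp (w j)) * ennreal (?L ^ N)" for j
    unfolding nn_integral_map_pmf shift exp_add ennreal_mult'[OF exp_ge_zero]
    by (subst nn_integral_cmult) (simp_all add: Suc.IH)
  have "(\<integral>\<^sup>+ j. ennreal (exp (w j)) \<partial>categorical_pmf q) =
      (\<Sum>j\<in>UNIV. ennreal (exp (w j)) * ennreal (q $ j))"
    by (subst nn_integral_measure_pmf_support[of UNIV]) (auto simp: pmf_categorical[OF assms])
  also have "\<dots> = (\<Sum>j\<in>UNIV. ennreal (q $ j * exp (w j)))"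
    by (intro sum.cong refl) (simp add: ennreal_mult' q0 mult.commute)
  also have "\<dots> = ennreal ?L"
    by (rule sum_ennreal) (simp add: q0)
  finally have cat: "(\<integral>\<^sup>+ j. ennreal (exp (w j)) \<partial>categorical_pmf q) = ennreal ?L" .
  have L0: "0 \<le> ?L"
    by (intro sum_nonneg mult_nonneg_nonneg q0) simp
  show ?case
    unfolding multinomial_pmf_Suc nn_integral_bind_pmf one
    by (simp add: nn_integral_multc cat ennreal_mult'[OF L0])
qed

lemma exp_chord:
  fixes w b l :: real
  assumes "0 \<le> w" "w \<le> b" "0 < b"
  shows "exp (l * w) \<le> 1 + w / b * (exp (l * b) - 1)"
proof -
  have "exp ((1 - w / b) *\<^sub>R 0 + (w / b) *\<^sub>R (l * b)) \<le> (1 - w / b) * exp 0 + w / b * exp (l * b)"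
    using assms by (intro convex_onD[OF exp_convex]) auto
  then show ?thesis using assms by (simp add: algebra_simps)
qed

text \<open>
  Markov's inequality for \<open>exp (l Z)\<close>, where \<open>Z\<close> is the weighted count. Replacing the exponential by
  its chord on \<open>[0, b]\<close> makes the exponential moment depend on the weights through the mean
  \<open>m = \<Sum>\<^sub>j q\<^sub>j w\<^sub>j\<close> of a single draw only, and \<open>N (m / b) (exp (l b) - 1)\<close> is the logarithmic moment
  generating function of \<open>b\<close> times a Poisson variable with mean \<open>N m / b\<close>. The sign of \<open>l\<close> is free,
  so both tails are covered.
\<close>

lemma multinomial_chernoff:
  fixes q :: "real ^ 'p"
  assumes q: "q \<in> prob_simplex" and "0 < b" and w: "\<And>j. 0 \<le> w j" "\<And>j. w j \<le> b"
  shows "measure_pmf.prob (multinomial_pmf N q) {c. a \<le> l * (\<Sum>j\<in>UNIV. w j * real (c j))} \<le>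
    exp (real N * ((\<Sum>j\<in>UNIV. q $ j * w j) / b) * (exp (l * b) - 1) - a)"
proof -
  let ?m = "\<Sum>j\<in>UNIV. q $ j * w j"
  let ?P = "measure_pmf (multinomial_pmf N q)"
  let ?Z = "\<lambda>c. \<Sum>j\<in>UNIV. (l * w j) * real (c j)"
  have q0: "q $ j \<ge> 0" for j
    using q by (simp add: prob_simplex_def)
  have q1: "(\<Sum>j\<in>UNIV. q $ j) = 1"
    using q by (simp add: prob_simplex_def)
  have Z: "l * (\<Sum>j\<in>UNIV. w j * real (c j)) = ?Z c" for c
    by (simp add: sum_distrib_left mult.assoc)
  have "(\<Sum>j\<in>UNIV. q $ j * exp (l * w j)) \<le> (\<Sum>j\<in>UNIV. q $ j * (1 + w j / b * (exp (l * b) - 1)))"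
    using assms q0 by (intro sum_mono mult_left_mono exp_chord) auto
  also have "\<dots> = 1 + ?m / b * (exp (l * b) - 1)"
    by (simp only: distrib_left sum.distrib q1 sum_divide_distrib sum_distrib_right) (simp add: q1 mult.assoc)
  also have "\<dots> \<le> exp (?m / b * (exp (l * b) - 1))"
    by (rule exp_ge_add_one_self)
  finally have L: "(\<Sum>j\<in>UNIV. q $ j * exp (l * w j)) \<le> exp (?m / b * (exp (l * b) - 1))" .
  have pt: "indicator {c. a \<le> ?Z c} c \<le> ennreal (exp (- a)) * ennreal (exp (?Z c))" for c
  proof -
    have "ennreal (exp (- a)) * ennreal (exp (?Z c)) = ennreal (exp (?Z c - a))"
      by (subst ennreal_mult'[symmetric]) (simp_all flip: exp_add)
    then show ?thesis
      by (cases "a \<le> ?Z c") (auto simp: ennreal_1[symmetric] simp del: ennreal_1 intro!: ennreal_leI)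
  qed
  have "emeasure ?P {c. a \<le> ?Z c} = (\<integral>\<^sup>+ c. indicator {c. a \<le> ?Z c} c \<partial>?P)"
    by simp
  also have "\<dots> \<le> (\<integral>\<^sup>+ c. ennreal (exp (- a)) * ennreal (exp (?Z c)) \<partial>?P)"
    by (intro nn_integral_mono pt)
  also have "\<dots> = ennreal (exp (- a) * (\<Sum>j\<in>UNIV. q $ j * exp (l * w j)) ^ N)"
    by (subst nn_integral_cmult) (simp_all add: multinomial_exp_moment[OF q] ennreal_mult'[OF exp_ge_zero])
  finally have "measure ?P {c. a \<le> ?Z c} \<le> exp (- a) * (\<Sum>j\<in>UNIV. q $ j * exp (l * w j)) ^ N"
    using q0 by (simp add: measure_pmf.emeasure_eq_measure sum_nonneg)
  also have "\<dots> \<le> exp (- a) * exp (?m / b * (exp (l * b) - 1)) ^ N"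
    using L q0 by (intro mult_left_mono power_mono sum_nonneg) auto
  also have "\<dots> = exp (real N * (?m / b) * (exp (l * b) - 1) - a)"
    by (simp add: exp_of_nat_mult[symmetric] exp_add[symmetric] mult.assoc)
  finally show ?thesis by (simp only: Z)
qed

lemma exp_remainder_le:
  fixes x :: real
  assumes "0 \<le> x"
  shows "(exp x - 1 - x) * (1 - x) \<le> x\<^sup>2 / 2"
proof -
  let ?f = "\<lambda>x::real. x\<^sup>2 / 2 - (exp x - 1 - x) * (1 - x)"
  have "?f 0 \<le> ?f x"
  proof (rule DERIV_nonneg_imp_nondecreasing[OF assms])
    fix y :: real assume "0 \<le> y"
    have "(?f has_real_derivative y * (exp y - 1)) (at y)"
      by (auto intro!: derivative_eq_intros simp: algebra_simps)
    then show "\<exists>d. (?f has_real_derivative d) (at y) \<and> 0 \<le> d"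
      using \<open>0 \<le> y\<close> by (intro exI[of _ "y * (exp y - 1)"]) auto
  qed
  then show ?thesis by simp
qed

lemma exp_minus_le_quadratic:
  fixes x :: real
  assumes "0 \<le> x"
  shows "exp (- x) \<le> 1 - x + x\<^sup>2 / 2"
proof -
  let ?f = "\<lambda>x::real. 1 - x + x\<^sup>2 / 2 - exp (- x)"
  have "?f 0 \<le> ?f x"
  proof (rule DERIV_nonneg_imp_nondecreasing[OF assms])
    fix y :: real assume "0 \<le> y"
    have "(?f has_real_derivative y - 1 + exp (- y)) (at y)"
      by (auto intro!: derivative_eq_intros simp: algebra_simps)
    moreover have "0 \<le> y - 1 + exp (- y)"
      using exp_ge_add_one_self[of "- y"] by simp
    ultimately show "\<exists>d. (?f has_real_derivative d) (at y) \<and> 0 \<le> d" by blast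
  qed
  then show ?thesis by simp
qed

text \<open>
  A Bernstein bound: the variance proxy is \<open>b\<close>, because weights in \<open>[0, b]\<close> whose mean is at most 1
  have second moment at most \<open>b\<close>.
\<close>

lemma multinomial_upper_tail:
  fixes q :: "real ^ 'p"
  assumes q: "q \<in> prob_simplex" and b: "0 < b" and w: "\<And>j. 0 \<le> w j" "\<And>j. w j \<le> b"
    and m: "(\<Sum>j\<in>UNIV. q $ j * w j) \<le> 1" and N: "0 < N" and t: "0 \<le> t"
  shows "measure_pmf.prob (multinomial_pmf N q)
      {c. real N * ((\<Sum>j\<in>UNIV. q $ j * w j) + sqrt (2 * b * t / N) + b * t / N)
        \<le> (\<Sum>j\<in>UNIV. w j * real (c j))} \<le> exp (- t)"
proof -
  define m where "m = (\<Sum>j\<in>UNIV. q $ j * w j)"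
  define u where "u = sqrt (2 * b * t / N)"
  (* x / b is the optimal exponent for the majorant x^2 / (2 (1 - x)) of exp x - 1 - x. *)
  define x where "x = u / (1 + u)"
  have u: "0 \<le> u" and u2: "b * t / N = u\<^sup>2 / 2"
    using b N t by (auto simp: u_def)
  have tu: "t = real N / b * (u\<^sup>2 / 2)"
    using b N by (simp flip: u2)
  have x: "0 \<le> x" "x < 1" "1 - x = 1 / (1 + u)"
    using u by (auto simp: x_def field_simps)
  have "exp x - 1 - x \<le> x\<^sup>2 / 2 / (1 - x)"
    by (subst pos_le_divide_eq) (use exp_remainder_le[OF x(1)] x(2) in simp_all)
  also have "\<dots> = u\<^sup>2 / (2 * (1 + u))"
  proof -
    have "1 + u \<noteq> 0" using u by simp
    then show ?thesis unfolding x(3) unfolding x_def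
      by (simp add: divide_simps) algebra
  qed
  finally have r: "exp x - 1 - x \<le> u\<^sup>2 / (2 * (1 + u))" .
  have m01: "0 \<le> m" "m \<le> 1"
    using q w assms(5) by (auto simp: m_def prob_simplex_def intro!: sum_nonneg)
  have "m * (exp x - 1 - x) \<le> 1 * (exp x - 1 - x)"
    using m01 exp_ge_add_one_self[of x] by (intro mult_right_mono; linarith)
  also have "\<dots> \<le> u\<^sup>2 / (2 * (1 + u))"
    using r by simp
  finally have "m * (exp x - 1 - x) - x * (u + u\<^sup>2 / 2) \<le>
      u\<^sup>2 / (2 * (1 + u)) - x * (u + u\<^sup>2 / 2)"
    by (rule diff_right_mono)
  also have "\<dots> = - (u\<^sup>2 / 2)"
  proof -
    have "1 + u \<noteq> 0" using u by simp
    then show ?thesis unfolding x_def by (simp add: divide_simps) algebra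
  qed
  finally have e: "m * (exp x - 1 - x) - x * (u + u\<^sup>2 / 2) \<le> - (u\<^sup>2 / 2)" .
  have "real N * (m / b) * (exp (x / b * b) - 1) - x / b * (real N * (m + u + u\<^sup>2 / 2))
      = real N / b * (m * (exp x - 1 - x) - x * (u + u\<^sup>2 / 2))"
    using b by (simp add: field_simps)
  also have "\<dots> \<le> real N / b * (- (u\<^sup>2 / 2))"
    using b e by (intro mult_left_mono) auto
  also have "\<dots> = - t" by (simp add: tu)
  finally have ex: "real N * (m / b) * (exp (x / b * b) - 1) - x / b * (real N * (m + u + u\<^sup>2 / 2)) \<le> - t" .
  have "measure_pmf.prob (multinomial_pmf N q)
      {c. real N * (m + u + u\<^sup>2 / 2) \<le> (\<Sum>j\<in>UNIV. w j * real (c j))} \<le>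
      measure_pmf.prob (multinomial_pmf N q)
      {c. x / b * (real N * (m + u + u\<^sup>2 / 2)) \<le> x / b * (\<Sum>j\<in>UNIV. w j * real (c j))}"
    using b x by (intro measure_pmf.finite_measure_mono) (auto intro!: divide_right_mono mult_left_mono)
  also have "\<dots> \<le> exp (real N * (m / b) * (exp (x / b * b) - 1) - x / b * (real N * (m + u + u\<^sup>2 / 2)))"
    unfolding m_def by (rule multinomial_chernoff[OF q b w])
  also have "\<dots> \<le> exp (- t)"
    by (subst exp_le_cancel_iff) (rule ex)
  finally show ?thesis by (simp only: m_def u_def[symmetric] u2)
qed

text \<open>
  The lower tail is sub-Gaussian: \<open>exp (- x) - 1 + x \<le> x\<^sup>2 / 2\<close> holds for all \<open>x \<ge> 0\<close>, so no linear
  correction term appears.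
\<close>

lemma multinomial_lower_tail:
  fixes q :: "real ^ 'p"
  assumes q: "q \<in> prob_simplex" and b: "0 < b" and w: "\<And>j. 0 \<le> w j" "\<And>j. w j \<le> b"
    and m: "(\<Sum>j\<in>UNIV. q $ j * w j) \<le> 1" and N: "0 < N" and t: "0 \<le> t"
  shows "measure_pmf.prob (multinomial_pmf N q)
      {c. (\<Sum>j\<in>UNIV. w j * real (c j))
        \<le> real N * ((\<Sum>j\<in>UNIV. q $ j * w j) - sqrt (2 * b * t / N))} \<le> exp (- t)"
proof -
  define m where "m = (\<Sum>j\<in>UNIV. q $ j * w j)"
  define u where "u = sqrt (2 * b * t / N)"
  have u: "0 \<le> u" and u2: "b * t / N = u\<^sup>2 / 2"
    using b N t by (auto simp: u_def)
  have tu: "t = real N / b * (u\<^sup>2 / 2)"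
    using b N by (simp flip: u2)
  have m01: "0 \<le> m" "m \<le> 1"
    using q w assms(5) by (auto simp: m_def prob_simplex_def intro!: sum_nonneg)
  have r: "0 \<le> exp (- u) - 1 + u" "exp (- u) - 1 + u \<le> u\<^sup>2 / 2"
    using exp_minus_le_quadratic[OF u] exp_ge_add_one_self[of "- u"] by auto
  have e: "m * (exp (- u) - 1 + u) - u * u \<le> - (u\<^sup>2 / 2)"
    using m01 r mult_right_mono[of m 1 "exp (- u) - 1 + u"] by (simp add: power2_eq_square)
  have "real N * (m / b) * (exp (- u / b * b) - 1) - (- u / b) * (real N * (m - u))
      = real N / b * (m * (exp (- u) - 1 + u) - u * u)"
    using b by (simp add: field_simps)
  also have "\<dots> \<le> real N / b * (- (u\<^sup>2 / 2))"
    using b e by (intro mult_left_mono) auto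
  also have "\<dots> = - t" by (simp add: tu)
  finally have ex: "real N * (m / b) * (exp (- u / b * b) - 1) - (- u / b) * (real N * (m - u)) \<le> - t" .
  have "measure_pmf.prob (multinomial_pmf N q)
      {c. (\<Sum>j\<in>UNIV. w j * real (c j)) \<le> real N * (m - u)} \<le>
      measure_pmf.prob (multinomial_pmf N q)
      {c. - u / b * (real N * (m - u)) \<le> - u / b * (\<Sum>j\<in>UNIV. w j * real (c j))}"
    using b u by (intro measure_pmf.finite_measure_mono subsetI CollectI mult_left_mono_neg) auto
  also have "\<dots> \<le> exp (real N * (m / b) * (exp (- u / b * b) - 1) - (- u / b) * (real N * (m - u)))"
    unfolding m_def by (rule multinomial_chernoff[OF q b w])
  also have "\<dots> \<le> exp (- t)"
    by (subst exp_le_cancel_iff) (rule ex)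
  finally show ?thesis by (simp only: m_def u_def[symmetric])
qed

lemma multinomial_deviation:
  fixes q :: "real ^ 'p"
  assumes q: "q \<in> prob_simplex" and b: "0 < b" and w: "\<And>j. 0 \<le> w j" "\<And>j. w j \<le> b"
    and m: "(\<Sum>j\<in>UNIV. q $ j * w j) \<le> 1" and N: "0 < N" and t: "0 \<le> t"
  shows "measure_pmf.prob (multinomial_pmf N q)
      {c. sqrt (2 * b * t / N) + b * t / N < \<bar>\<Sum>j\<in>UNIV. (real (c j) / N - q $ j) * w j\<bar>}
    \<le> 2 * exp (- t)"
proof -
  let ?P = "measure_pmf.prob (multinomial_pmf N q)"
  let ?m = "\<Sum>j\<in>UNIV. q $ j * w j"
  let ?S = "\<lambda>c. \<Sum>j\<in>UNIV. w j * real (c j)"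
  let ?a = "sqrt (2 * b * t / N)" and ?b = "b * t / N"
  let ?U = "{c. real N * (?m + ?a + ?b) \<le> ?S c}"
  let ?L = "{c. ?S c \<le> real N * (?m - ?a)}"
  have b0: "0 \<le> ?b" using b t by simp
  have dev: "(\<Sum>j\<in>UNIV. (real (c j) / N - q $ j) * w j) = ?S c / N - ?m" for c
    by (simp add: left_diff_distrib right_diff_distrib sum_subtractf sum_divide_distrib mult.commute)
  have "{c. ?a + ?b < \<bar>\<Sum>j\<in>UNIV. (real (c j) / N - q $ j) * w j\<bar>} \<subseteq> ?U \<union> ?L"
  proof
    fix c assume "c \<in> {c. ?a + ?b < \<bar>\<Sum>j\<in>UNIV. (real (c j) / N - q $ j) * w j\<bar>}"
    then have "?m + ?a + ?b \<le> ?S c / N \<or> ?S c / N \<le> ?m - ?a"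
      unfolding dev mem_Collect_eq using b0 by argo
    then show "c \<in> ?U \<union> ?L"
      using N by (simp add: field_simps)
  qed
  then have "?P {c. ?a + ?b < \<bar>\<Sum>j\<in>UNIV. (real (c j) / N - q $ j) * w j\<bar>} \<le> ?P (?U \<union> ?L)"
    by (intro measure_pmf.finite_measure_mono) auto
  also have "\<dots> \<le> ?P ?U + ?P ?L"
    by (rule measure_Un_le) auto
  also have "\<dots> \<le> exp (- t) + exp (- t)"
    by (intro add_mono multinomial_upper_tail multinomial_lower_tail assms)
  finally show ?thesis by simp
qed

text \<open>
  The exponent comes from \<open>multinomial_chernoff\<close> with the indicator of cell \<open>j\<close> as weight and
  \<open>l = - 1/2\<close>, using \<open>exp (- 1/2) - 1 \<le> - 3/8\<close>.
\<close>

lemma multinomial_cell_half_lower_tail: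
  fixes q :: "real ^ 'p"
  assumes q: "q \<in> prob_simplex"
  shows "measure_pmf.prob (multinomial_pmf N q) {c. real (c j) \<le> real N * q $ j / 2}
    \<le> exp (- (real N * q $ j / 8))"
proof -
  let ?w = "\<lambda>k. if k = j then 1 else 0 :: real"
  have q0: "q $ j \<ge> 0" using q by (simp add: prob_simplex_def)
  have s: "(\<Sum>k\<in>UNIV. ?w k * real (c k)) = real (c j)" for c
    by (simp add: if_distrib[of "\<lambda>x. x * _"] cong: if_cong)
  have s': "(\<Sum>k\<in>UNIV. q $ k * ?w k) = q $ j"
    by (simp add: if_distrib cong: if_cong)
  have "exp (- (1/2)) - 1 \<le> - (3/8 :: real)"
    using exp_minus_le_quadratic[of "1/2"] by (simp add: power2_eq_square)
  then have "real N * q $ j * (exp (- (1/2)) - 1) \<le> real N * q $ j * - (3/8)"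
    using q0 by (intro mult_left_mono) auto
  then have ex: "real N * (q $ j / 1) * (exp (- (1/2) * 1) - 1) - - (1/2) * (real N * q $ j / 2)
      \<le> - (real N * q $ j / 8)"
    by simp
  have "measure_pmf.prob (multinomial_pmf N q) {c. real (c j) \<le> real N * q $ j / 2} =
      measure_pmf.prob (multinomial_pmf N q)
        {c. - (1/2) * (real N * q $ j / 2) \<le> - (1/2) * (\<Sum>k\<in>UNIV. ?w k * real (c k))}"
    unfolding s by (rule arg_cong[of _ _ "measure_pmf.prob _"]) auto
  also have "\<dots> \<le> exp (real N * (q $ j / 1) * (exp (- (1/2) * 1) - 1) - - (1/2) * (real N * q $ j / 2))"
    unfolding s'[symmetric] by (rule multinomial_chernoff[OF q]) auto
  also have "\<dots> \<le> exp (- (real N * q $ j / 8))"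
    by (subst exp_le_cancel_iff) (rule ex)
  finally show ?thesis .
qed

section \<open>First-order optimality of the maximum likelihood estimate\<close>

lemma prob_simplex_segment:
  assumes "T \<in> prob_simplex" "U \<in> prob_simplex" "0 \<le> h" "h \<le> 1"
  shows "T + h *\<^sub>R (U - T) \<in> prob_simplex"
proof -
  have "0 \<le> T $ j + h * (U $ j - T $ j)" for j
  proof -
    have "0 \<le> (1 - h) * T $ j + h * U $ j"
      using assms by (intro add_nonneg_nonneg mult_nonneg_nonneg) (auto simp: prob_simplex_def)
    then show ?thesis by (simp add: algebra_simps)
  qed
  moreover have "(\<Sum>j\<in>UNIV. T $ j + h * (U $ j - T $ j)) = 1"
    using assms by (simp add: sum.distrib sum_subtractf prob_simplex_def flip: sum_distrib_left)
  ultimately show ?thesis by (simp add: prob_simplex_def)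
qed

lemma loglik_eq_ereal:
  assumes "\<And>j. 0 < x $ j \<Longrightarrow> 0 < A $ j \<bullet> T"
  shows "loglik A x T = ereal (\<Sum>j | 0 < x $ j. x $ j * ln (A $ j \<bullet> T))"
  unfolding loglik_def using assms by (subst sum_ereal[symmetric]) (auto simp: eln_def intro!: sum.cong)

text \<open>
  A competitor that gives positive probability to every observed cell has finite log-likelihood,
  whereas missing an observed cell costs \<open>-\<infinity>\<close>. This turns the extended-real likelihood into
  an ordinary differentiable function near the estimate.
\<close>

lemma mle_fits_observed_cells:
  assumes mle: "is_mle A x That" and T: "T \<in> prob_simplex"
    and fit: "\<And>j. 0 < x $ j \<Longrightarrow> 0 < A $ j \<bullet> T" and i: "0 < x $ i"
  shows "0 < A $ i \<bullet> That"
proof (rule ccontr)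
  assume "\<not> 0 < A $ i \<bullet> That"
  then have "ereal (x $ i) * eln (A $ i \<bullet> That) = - \<infinity>"
    using i by (simp add: eln_def)
  moreover have "(\<Sum>j\<in>{j. 0 < x $ j} - {i}. ereal (x $ j) * eln (A $ j \<bullet> That)) \<noteq> \<infinity>"
    by (auto simp: sum_Pinfty eln_def)
  ultimately have "loglik A x That = - \<infinity>"
    unfolding loglik_def using i by (subst sum.remove[of _ i]) auto
  then have "loglik A x That < loglik A x T"
    by (simp add: loglik_eq_ereal[OF fit])
  then show False
    using mle T by (auto simp: is_mle_def is_arg_max_def)
qed

text \<open>
  The sum is the derivative at \<open>h = 0\<close> of the log-likelihood along the segment from \<open>That\<close> to \<open>T\<close>.
  Were it positive, a short step along the segment, which stays in the simplex, would improve on a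
  maximiser.
\<close>

lemma mle_score_nonpos:
  assumes mle: "is_mle A x That" and T: "T \<in> prob_simplex"
    and fit: "\<And>j. 0 < x $ j \<Longrightarrow> 0 < A $ j \<bullet> T"
  shows "(\<Sum>j | 0 < x $ j. x $ j * ((A $ j \<bullet> T - A $ j \<bullet> That) / (A $ j \<bullet> That))) \<le> 0"
proof (rule ccontr)
  let ?J = "{j. 0 < x $ j}"
  let ?F = "\<lambda>h. \<Sum>j\<in>?J. x $ j * ln (A $ j \<bullet> That + h * (A $ j \<bullet> T - A $ j \<bullet> That))"
  let ?D = "\<Sum>j\<in>?J. x $ j * ((A $ j \<bullet> T - A $ j \<bullet> That) / (A $ j \<bullet> That))"
  assume "\<not> ?D \<le> 0"
  have pos: "0 < A $ j \<bullet> That" if "j \<in> ?J" for j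
    using mle_fits_observed_cells[OF mle T fit] that by simp
  have That: "That \<in> prob_simplex"
    using mle by (simp add: is_mle_def is_arg_max_def)
  have deriv: "((\<lambda>h. c * ln (a + h * b)) has_real_derivative c * (b / a)) (at 0)"
    if "0 < a" for a b c :: real
    by (rule derivative_eq_intros refl | use that in simp)+
  have der: "(?F has_real_derivative ?D) (at 0)"
    by (intro DERIV_sum deriv pos)
  have "0 < ?D"
    using \<open>\<not> ?D \<le> 0\<close> by (rule not_le_imp_less)
  from DERIV_pos_inc_right[OF der this]
  obtain d where d: "d > 0" "\<forall>h>0. h < d \<longrightarrow> ?F 0 < ?F (0 + h)"
    by (elim exE conjE)
  define h where "h = min (d / 2) 1"
  have h: "0 < h" "h < d" "h \<le> 1"
    using d(1) by (auto simp: h_def)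
  let ?U = "That + h *\<^sub>R (T - That)"
  have U: "A $ j \<bullet> ?U = A $ j \<bullet> That + h * (A $ j \<bullet> T - A $ j \<bullet> That)" for j
    by (simp add: inner_add_right inner_diff_right)
  have "0 < A $ j \<bullet> ?U" if "0 < x $ j" for j
  proof -
    have "0 < (1 - h) * (A $ j \<bullet> That) + h * (A $ j \<bullet> T)"
      using h pos[of j] fit[of j] that by (intro add_nonneg_pos mult_nonneg_nonneg mult_pos_pos) auto
    then show ?thesis unfolding U by (simp add: algebra_simps)
  qed
  then have "loglik A x ?U = ereal (?F h)"
    by (subst loglik_eq_ereal) (simp_all only: U)
  moreover have "loglik A x That = ereal (?F 0)"
    using pos by (subst loglik_eq_ereal) auto
  moreover have "?F 0 < ?F h"
    using d(2)[rule_format, OF h(1,2)] by simp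
  ultimately have "loglik A x That < loglik A x ?U" by simp
  moreover have "?U \<in> prob_simplex"
    using prob_simplex_segment[OF That T] h by simp
  ultimately show False
    using mle by (auto simp: is_mle_def is_arg_max_def)
qed

section \<open>The error on a regular sample\<close>

lemma kappa_le_ratio:
  assumes v: "v \<in> dominated_cone S" and S: "card S \<le> s"
  shows "kappa M s * l1norm v \<le> l1norm (M *v v)"
proof -
  have nn: "0 \<le> l1norm (u :: real ^ 'z)" for u
    by (simp add: l1norm_def sum_nonneg)
  have "v \<noteq> 0"
    using v by (simp add: dominated_cone_def)
  then obtain k where "v $ k \<noteq> 0"
    by (auto simp: vec_eq_iff)
  then have "0 < l1norm v"
    unfolding l1norm_def by (intro sum_pos2[of _ k]) auto
  moreover have "kappa M s \<le> l1norm (M *v v) / l1norm v"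
    unfolding kappa_def
  proof (rule cInf_lower)
    show "bdd_below {l1norm (M *v v) / l1norm v | S v. card S \<le> s \<and> v \<in> dominated_cone S}"
      by (rule bdd_belowI[of _ 0]) (auto simp: nn l1norm_def intro!: divide_nonneg_nonneg sum_nonneg)
  qed (use v S in blast)
  ultimately show ?thesis
    by (simp add: pos_le_divide_eq)
qed

text \<open>
  Both points have mass 1, so whatever mass \<open>U\<close> puts outside the support of \<open>T\<close> is missing inside it.
\<close>

lemma simplex_error_in_cone:
  assumes T: "T \<in> prob_simplex" and U: "U \<in> prob_simplex" and "U \<noteq> T"
  shows "U - T \<in> dominated_cone (supp T)"
proof -
  let ?S = "supp T"
  have 1: "(\<Sum>k\<in>?S. T $ k) = 1"
  proof -
    have "(\<Sum>k\<in>?S. T $ k) = (\<Sum>k\<in>UNIV. T $ k)"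
      by (rule sum.mono_neutral_left) (auto simp: supp_def)
    then show ?thesis using T by (simp add: prob_simplex_def)
  qed
  have 2: "(\<Sum>k\<in>?S. U $ k) + (\<Sum>k\<in>- ?S. U $ k) = 1"
    using U by (subst sum.union_disjoint[symmetric]) (auto simp: prob_simplex_def Compl_partition)
  have "(\<Sum>k\<in>- ?S. \<bar>(U - T) $ k\<bar>) = (\<Sum>k\<in>- ?S. U $ k)"
    using U by (intro sum.cong) (auto simp: prob_simplex_def supp_def)
  also have "\<dots> = (\<Sum>k\<in>?S. T $ k - U $ k)"
    using 1 2 by (simp add: sum_subtractf)
  also have "\<dots> \<le> (\<Sum>k\<in>?S. \<bar>(U - T) $ k\<bar>)"
    by (intro sum_mono) auto
  finally show ?thesis
    using assms(3) by (simp add: dominated_cone_def)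
qed

lemma stochastic_image_simplex:
  fixes A :: "real ^ 'k ^ 'p"
  assumes cols: "\<And>k. column k A \<in> prob_simplex" and V: "V \<in> prob_simplex"
  shows "A *v V \<in> prob_simplex"
proof -
  have A0: "0 \<le> A $ j $ k" and A1: "(\<Sum>j\<in>UNIV. A $ j $ k) = 1" for j k
    using cols[of k] by (auto simp: prob_simplex_def column_def)
  have "(\<Sum>j\<in>UNIV. (A *v V) $ j) = (\<Sum>k\<in>UNIV. (\<Sum>j\<in>UNIV. A $ j $ k) * V $ k)"
    unfolding matrix_vector_mult_def sum_distrib_right by simp (rule sum.swap)
  also have "\<dots> = 1"
    using V by (simp add: A1 prob_simplex_def)
  finally show ?thesis
    using V A0 by (auto simp: prob_simplex_def matrix_vector_mult_def intro!: sum_nonneg)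
qed

text \<open>
  The probability-free part of the argument, for an arbitrary set \<open>U\<close> of cells whose empirical
  frequency is at least half of the true probability. The basic inequality bounds a weighted
  quadratic form in the fitted error by \<open>\<delta>\<close> times the \<open>\<ell>\<^sub>1\<close>-error; the quadratic form dominates
  \<open>\<kappa>\<^sup>2 / 2\<close> times the squared \<open>\<ell>\<^sub>1\<close>-error.
\<close>

lemma mle_l1_error_of_regular_sample:
  fixes A :: "real ^ 'k ^ 'p" and T That :: "real ^ 'k" and x :: "real ^ 'p"
  defines "q \<equiv> A *v T"
  assumes cols: "\<And>k. column k A \<in> prob_simplex"
    and T: "T \<in> prob_simplex" and card: "card (supp T) \<le> s"
    and mle: "is_mle A x That"
    and x0: "\<And>j. 0 \<le> x $ j" and supp: "\<And>j. q $ j = 0 \<Longrightarrow> x $ j = 0"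
    and half: "\<And>j. j \<in> U \<Longrightarrow> 0 < q $ j \<and> q $ j / 2 \<le> x $ j"
    and dev: "\<And>k. \<bar>\<Sum>j\<in>UNIV. (x $ j - q $ j) * (A $ j $ k / q $ j)\<bar> \<le> \<delta>"
    and kappa: "0 < kappa (rows_in A U) s"
  shows "l1norm (That - T) \<le> 2 / (kappa (rows_in A U) s)\<^sup>2 * \<delta>"
proof -
  define r where "r = A *v That"
  define d where "d = r - q"
  define D where "D = l1norm (That - T)"
  let ?J = "{j. 0 < x $ j}"
  have That: "That \<in> prob_simplex"
    using mle by (simp add: is_mle_def is_arg_max_def)
  have q: "\<And>j. 0 \<le> q $ j" "(\<Sum>j\<in>UNIV. q $ j) = 1"
    and r: "\<And>j. 0 \<le> r $ j" "(\<Sum>j\<in>UNIV. r $ j) = 1"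
    using stochastic_image_simplex[OF cols T] stochastic_image_simplex[OF cols That]
    by (auto simp: prob_simplex_def q_def r_def)
  have qJ: "0 < q $ j" if "j \<in> ?J" for j
    using supp[of j] q(1)[of j] that by fastforce
  have inner: "A $ j \<bullet> T = q $ j" "A $ j \<bullet> That = r $ j" for j
    by (simp_all add: q_def r_def matrix_vector_mul_component)
  have fit: "0 < A $ j \<bullet> T" if "0 < x $ j" for j
    using qJ that by (simp add: inner)
  have rJ: "0 < r $ j" if "j \<in> ?J" for j
    using mle_fits_observed_cells[OF mle T fit] that by (simp add: inner)
  have "(\<Sum>j\<in>?J. x $ j * ((q $ j - r $ j) / r $ j)) \<le> 0"
    using mle_score_nonpos[OF mle T fit] by (simp add: inner)
  then have score: "0 \<le> (\<Sum>j\<in>?J. x $ j * (d $ j / r $ j))"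
    by (simp add: d_def diff_divide_distrib right_diff_distrib sum_subtractf)
  (* Expanding d = A (That - T) exhibits the deviations of the K weighted counts. *)
  have lin: "(\<Sum>j\<in>UNIV. (x $ j - q $ j) * (d $ j / q $ j)) \<le> D * \<delta>"
  proof -
    have dj: "d $ j = (\<Sum>k\<in>UNIV. A $ j $ k * (That - T) $ k)" for j
      by (simp add: d_def r_def q_def matrix_vector_mult_def right_diff_distrib sum_subtractf)
    have "(\<Sum>j\<in>UNIV. (x $ j - q $ j) * (d $ j / q $ j)) =
        (\<Sum>j\<in>UNIV. \<Sum>k\<in>UNIV. (That - T) $ k * ((x $ j - q $ j) * (A $ j $ k / q $ j)))"
      unfolding dj sum_divide_distrib sum_distrib_left
      by (intro sum.cong refl) (simp only: divide_inverse mult_ac)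
    also have "\<dots> = (\<Sum>k\<in>UNIV. (That - T) $ k * (\<Sum>j\<in>UNIV. (x $ j - q $ j) * (A $ j $ k / q $ j)))"
      by (subst sum.swap) (simp add: sum_distrib_left)
    also have "\<dots> \<le> (\<Sum>k\<in>UNIV. \<bar>(That - T) $ k\<bar> * \<delta>)"
    proof (intro sum_mono)
      fix k
      let ?g = "\<Sum>j\<in>UNIV. (x $ j - q $ j) * (A $ j $ k / q $ j)"
      have "(That - T) $ k * ?g \<le> \<bar>(That - T) $ k\<bar> * \<bar>?g\<bar>"
        unfolding abs_mult[symmetric] by (rule abs_ge_self)
      also have "\<dots> \<le> \<bar>(That - T) $ k\<bar> * \<delta>"
        by (intro mult_left_mono dev abs_ge_zero)
      finally show "(That - T) $ k * ?g \<le> \<bar>(That - T) $ k\<bar> * \<delta>" .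
    qed
    finally show ?thesis by (simp add: D_def l1norm_def sum_distrib_right)
  qed
  (* The summands are d j where q j > 0 and 0 elsewhere, and off the support d j = r j \<ge> 0. *)
  have drift: "(\<Sum>j\<in>UNIV. q $ j * (d $ j / q $ j)) \<le> 0"
  proof -
    have "(\<Sum>j\<in>UNIV. q $ j * (d $ j / q $ j)) \<le> (\<Sum>j\<in>UNIV. d $ j)"
      using r(1) by (intro sum_mono) (auto simp: d_def)
    then show ?thesis by (simp add: d_def sum_subtractf q r)
  qed
  have "(\<Sum>j\<in>?J. x $ j * ((d $ j)\<^sup>2 / (q $ j * r $ j)))
      = (\<Sum>j\<in>?J. x $ j * (d $ j / q $ j)) - (\<Sum>j\<in>?J. x $ j * (d $ j / r $ j))"
    unfolding sum_subtractf[symmetric]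
  proof (intro sum.cong refl)
    fix j assume "j \<in> ?J"
    then have "q $ j \<noteq> 0" "r $ j \<noteq> 0" using qJ[of j] rJ[of j] by auto
    moreover have "d $ j = r $ j - q $ j" by (simp add: d_def)
    ultimately show "x $ j * ((d $ j)\<^sup>2 / (q $ j * r $ j)) =
        x $ j * (d $ j / q $ j) - x $ j * (d $ j / r $ j)"
      by (simp add: divide_simps) (simp add: power2_eq_square algebra_simps)
  qed
  also have "(\<Sum>j\<in>?J. x $ j * (d $ j / q $ j)) = (\<Sum>j\<in>UNIV. x $ j * (d $ j / q $ j))"
    using x0 by (intro sum.mono_neutral_left) (auto simp: less_le)
  also have "\<dots> = (\<Sum>j\<in>UNIV. (x $ j - q $ j) * (d $ j / q $ j)) + (\<Sum>j\<in>UNIV. q $ j * (d $ j / q $ j))"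
    by (simp only: sum.distrib[symmetric] distrib_right[symmetric]) simp
  finally have upper: "(\<Sum>j\<in>?J. x $ j * ((d $ j)\<^sup>2 / (q $ j * r $ j))) \<le> D * \<delta>"
    using lin drift score by linarith
  have UJ: "U \<subseteq> ?J"
    using half by (force dest: half)
  have "1 / 2 * (\<Sum>j\<in>U. (d $ j)\<^sup>2 / r $ j) \<le> (\<Sum>j\<in>U. x $ j * ((d $ j)\<^sup>2 / (q $ j * r $ j)))"
    unfolding sum_distrib_left
  proof (intro sum_mono)
    fix j assume "j \<in> U"
    then have "0 < q $ j" "1 / 2 * q $ j \<le> x $ j" "0 < r $ j"
      using half[of j] rJ[of j] UJ by auto
    moreover from this have "1 / 2 * ((d $ j)\<^sup>2 / r $ j) = (1 / 2 * q $ j) * ((d $ j)\<^sup>2 / (q $ j * r $ j))"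
      by simp
    ultimately show "1 / 2 * ((d $ j)\<^sup>2 / r $ j) \<le> x $ j * ((d $ j)\<^sup>2 / (q $ j * r $ j))"
      by (metis mult_right_mono divide_nonneg_pos mult_pos_pos zero_le_power2)
  qed
  also have "\<dots> \<le> (\<Sum>j\<in>?J. x $ j * ((d $ j)\<^sup>2 / (q $ j * r $ j)))"
    using UJ by (intro sum_mono2) (auto simp: x0 q r)
  finally have lower: "1 / 2 * (\<Sum>j\<in>U. (d $ j)\<^sup>2 / r $ j) \<le> D * \<delta>"
    using upper by linarith
  have "l1norm (rows_in A U *v (That - T)) = (\<Sum>j\<in>U. \<bar>d $ j\<bar>)"
  proof -
    have "\<bar>(rows_in A U *v (That - T)) $ j\<bar> = (if j \<in> U then \<bar>d $ j\<bar> else 0)" for j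
      by (simp add: matrix_vector_mul_component rows_in_def d_def inner_diff_right inner)
    then show ?thesis by (simp add: l1norm_def sum.If_cases)
  qed
  also have "\<dots> = (\<Sum>j\<in>U. \<bar>d $ j\<bar> / sqrt (r $ j) * sqrt (r $ j))"
  proof (intro sum.cong refl)
    fix j assume "j \<in> U"
    then have "0 < sqrt (r $ j)" using rJ[of j] UJ by auto
    then show "\<bar>d $ j\<bar> = \<bar>d $ j\<bar> / sqrt (r $ j) * sqrt (r $ j)" by simp
  qed
  finally have cs0: "l1norm (rows_in A U *v (That - T)) = (\<Sum>j\<in>U. \<bar>d $ j\<bar> / sqrt (r $ j) * sqrt (r $ j))" .
  (* Cauchy-Schwarz is applied to the factorisation by the square roots of the fitted masses. *)
  have "(l1norm (rows_in A U *v (That - T)))\<^sup>2 \<le>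
      (\<Sum>j\<in>U. (\<bar>d $ j\<bar> / sqrt (r $ j))\<^sup>2) * (\<Sum>j\<in>U. (sqrt (r $ j))\<^sup>2)"
    unfolding cs0 by (rule Cauchy_Schwarz_ineq_sum)
  also have "\<dots> = (\<Sum>j\<in>U. (d $ j)\<^sup>2 / r $ j) * (\<Sum>j\<in>U. r $ j)"
    by (simp add: power_divide r(1))
  also have "\<dots> \<le> (\<Sum>j\<in>U. (d $ j)\<^sup>2 / r $ j) * (\<Sum>j\<in>UNIV. r $ j)"
    by (intro mult_left_mono sum_mono2 sum_nonneg divide_nonneg_nonneg r(1)) auto
  finally have cs: "(l1norm (rows_in A U *v (That - T)))\<^sup>2 \<le> 2 * (D * \<delta>)"
    using lower r(2) by simp
  show ?thesis
  proof (cases "That = T")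
    case True
    have "0 \<le> \<delta>" using dev abs_ge_zero order_trans by blast
    then show ?thesis using True by (simp add: l1norm_def)
  next
    case False
    let ?\<kappa> = "kappa (rows_in A U) s"
    obtain k where "(That - T) $ k \<noteq> 0"
      using False by (auto simp: vec_eq_iff)
    then have D: "0 < D"
      unfolding D_def l1norm_def by (intro sum_pos2[of _ k]) auto
    have "?\<kappa> * D \<le> l1norm (rows_in A U *v (That - T))"
      unfolding D_def by (rule kappa_le_ratio[OF simplex_error_in_cone[OF T That False] card])
    then have "(?\<kappa> * D)\<^sup>2 \<le> (l1norm (rows_in A U *v (That - T)))\<^sup>2"
      using kappa D by (intro power_mono) auto
    with cs have "D * (?\<kappa>\<^sup>2 * D) \<le> D * (2 * \<delta>)"
      by (simp add: power2_eq_square algebra_simps)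
    then have "?\<kappa>\<^sup>2 * D \<le> 2 * \<delta>"
      using D by simp
    then show ?thesis
      using kappa by (simp add: D_def[symmetric] pos_le_divide_eq mult.commute)
  qed
qed

section \<open>Probability of a regular sample\<close>

text \<open>
  The square-root term of the threshold gives \<open>q\<^sub>j > 4 sqrt (q\<^sub>j log p / N)\<close>, hence
  \<open>N q\<^sub>j > 16 log p\<close> after squaring, which makes the halving bound of such a cell at most \<open>1 / p\<^sup>2\<close>.
\<close>

lemma Jlow_expected_count:
  fixes q :: "real ^ 'p"
  assumes "0 < N" "q \<in> prob_simplex" "j \<in> Jlow N q"
  shows "0 < q $ j" "2 * ln (real CARD('p)) \<le> real N * q $ j / 8"
proof -
  let ?L = "ln (real CARD('p))"
  have L: "0 \<le> ?L" by simp
  have q0: "0 \<le> q $ j" using assms(2) by (simp add: prob_simplex_def)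
  have a: "0 \<le> sqrt (q $ j * ?L / N)" using L q0 by simp
  have "4 * sqrt (q $ j * ?L / N) + 8 * ?L / (3 * real N) < q $ j"
    using assms(3) by (simp add: Jlow_def eps_cell_def)
  moreover have "0 \<le> 8 * ?L / (3 * real N)" using L by simp
  ultimately have lt: "4 * sqrt (q $ j * ?L / N) < q $ j" by linarith
  with a show pos: "0 < q $ j" by linarith
  have "(4 * sqrt (q $ j * ?L / N))\<^sup>2 \<le> (q $ j)\<^sup>2"
    using lt a by (intro power_mono) auto
  then have "16 * (q $ j * ?L / N) \<le> (q $ j)\<^sup>2"
    using q0 L by (simp add: power_mult_distrib)
  then have "q $ j * (16 * ?L) \<le> q $ j * (real N * q $ j)"
    using assms(1) by (simp add: field_simps power2_eq_square)
  then show "2 * ?L \<le> real N * q $ j / 8"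
    using pos by simp
qed

text \<open>
  The weights \<open>A\<^sub>j\<^sub>k / q\<^sub>j\<close> satisfy what the tail bounds ask for, with \<open>b = \<rho>\<close>. On cells with \<open>q\<^sub>j = 0\<close>
  the quotient is 0 by the convention on division, so that the sums may range over all cells; the
  mean of a weight is then the mass of the column on the support of \<open>q\<close>, hence at most 1.
\<close>

lemma column_ratio_bounds:
  fixes A :: "real ^ 'k ^ 'p"
  assumes cols: "\<And>k. column k A \<in> prob_simplex" and q: "q \<in> prob_simplex"
    and dom: "\<And>j. q $ j \<noteq> 0 \<Longrightarrow> A $ j \<noteq> 0"
  shows "0 < rho A q" "0 \<le> A $ j $ k / q $ j" "A $ j $ k / q $ j \<le> rho A q"
    "(\<Sum>j\<in>UNIV. q $ j * (A $ j $ k / q $ j)) \<le> 1"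
proof -
  have q0: "0 \<le> q $ j" for j using q by (simp add: prob_simplex_def)
  have A0: "0 \<le> A $ j $ k" and A1: "(\<Sum>j\<in>UNIV. A $ j $ k) = 1" for j k
    using cols[of k] by (auto simp: prob_simplex_def column_def)
  have rho: "infnorm (A $ j) / q $ j \<le> rho A q" if "0 < q $ j" for j
    using that unfolding rho_def by (intro Max_ge) (auto simp: Jbar_def)
  have "\<exists>j. q $ j \<noteq> 0"
  proof (rule ccontr)
    assume "\<nexists>j. q $ j \<noteq> 0"
    then show False using q by (simp add: prob_simplex_def)
  qed
  then obtain i where i: "0 < q $ i"
    using q0 by (metis less_le)
  then have "0 < infnorm (A $ i) / q $ i"
    using dom[of i] by (simp add: infnorm_pos_lt)
  with rho[OF i] show pos: "0 < rho A q" by linarith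
  show "0 \<le> A $ j $ k / q $ j" using A0 q0 by simp
  show "A $ j $ k / q $ j \<le> rho A q"
  proof (cases "q $ j = 0")
    case True
    then show ?thesis using pos by simp
  next
    case False
    then have j: "0 < q $ j" using q0[of j] by simp
    have "A $ j $ k \<le> infnorm (A $ j)"
      using component_le_infnorm_cart[of "A $ j" k] by linarith
    then have "A $ j $ k / q $ j \<le> infnorm (A $ j) / q $ j"
      using j by (intro divide_right_mono) auto
    then show ?thesis using rho[OF j] by linarith
  qed
  have "(\<Sum>j\<in>UNIV. q $ j * (A $ j $ k / q $ j)) \<le> (\<Sum>j\<in>UNIV. A $ j $ k)"
    using A0 by (intro sum_mono) auto
  then show "(\<Sum>j\<in>UNIV. q $ j * (A $ j $ k / q $ j)) \<le> 1" by (simp add: A1)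
qed

text \<open>
  Up to a null set, a sample that is not regular has either a cell of \<open>Jlow\<close> with less than half of
  its expected count, which costs at most \<open>p \<sqdot> p\<^sup>-\<^sup>2\<close> in total, or a column with a large deviation, which
  costs \<open>2 exp (- t) = 2 \<epsilon> / K\<close> for each of the \<open>K\<close> columns.
\<close>

lemma multinomial_regular_event:
  fixes A :: "real ^ 'k ^ 'p" and q :: "real ^ 'p"
  assumes cols: "\<And>k. column k A \<in> prob_simplex" and q: "q \<in> prob_simplex"
    and dom: "\<And>j. q $ j \<noteq> 0 \<Longrightarrow> A $ j \<noteq> 0"
    and N: "0 < N" and \<epsilon>: "0 < \<epsilon>" "\<epsilon> \<le> real CARD('k)"
  defines "t \<equiv> ln (real CARD('k) / \<epsilon>)"
  shows "1 - 1 / real CARD('p) - 2 * \<epsilon> \<le> measure_pmf.prob (multinomial_pmf N q)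
    {c. (\<forall>j. q $ j = 0 \<longrightarrow> c j = 0) \<and> (\<forall>j\<in>Jlow N q. real N * q $ j / 2 \<le> real (c j)) \<and>
        (\<forall>k. \<bar>\<Sum>j\<in>UNIV. (real (c j) / N - q $ j) * (A $ j $ k / q $ j)\<bar>
          \<le> sqrt (2 * rho A q * t / N) + rho A q * t / N)}"
    (is "_ \<le> measure_pmf.prob ?mn ?G")
proof -
  let ?P = "measure_pmf.prob ?mn"
  let ?p = "real CARD('p)"
  let ?H = "\<lambda>j. {c. real (c j) \<le> real N * q $ j / 2}"
  let ?D = "\<lambda>k. {c. sqrt (2 * rho A q * t / N) + rho A q * t / N <
      \<bar>\<Sum>j\<in>UNIV. (real (c j) / N - q $ j) * (A $ j $ k / q $ j)\<bar>}"
  have p: "0 < ?p" by simp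
  have t: "0 \<le> t" "exp (- t) = \<epsilon> / real CARD('k)"
    using \<epsilon> by (auto simp: t_def exp_minus exp_ln field_simps)
  have supp: "c j = 0" if "c \<in> set_pmf ?mn" "q $ j = 0" for c j
  proof (rule ccontr)
    assume "c j \<noteq> 0"
    then have "(\<Prod>j\<in>UNIV. (q $ j) ^ c j) = 0"
      using that(2) by (auto simp: power_0_left intro!: bexI[of _ j])
    then have "pmf ?mn c = 0" by (simp add: pmf_multinomial[OF q])
    then show False using that(1) by (simp add: set_pmf_iff)
  qed
  have H: "?P (?H j) \<le> 1 / ?p\<^sup>2" if "j \<in> Jlow N q" for j
  proof -
    have "?P (?H j) \<le> exp (- (real N * q $ j / 8))"
      by (rule multinomial_cell_half_lower_tail[OF q])
    also have "\<dots> \<le> exp (- (2 * ln ?p))"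
      using Jlow_expected_count(2)[OF N q that] by simp
    also have "\<dots> = 1 / ?p\<^sup>2"
      using p by (simp add: exp_minus exp_double inverse_eq_divide)
    finally show ?thesis .
  qed
  have D: "?P (?D k) \<le> 2 * (\<epsilon> / real CARD('k))" for k
    unfolding t(2)[symmetric]
    by (intro multinomial_deviation column_ratio_bounds[OF cols q dom] q N t(1))
  have "?P (- ?G) = ?P (- ?G \<inter> set_pmf ?mn)"
    by (simp add: measure_Int_set_pmf)
  also have "\<dots> \<le> ?P ((\<Union>j\<in>Jlow N q. ?H j) \<union> (\<Union>k. ?D k))"
    using supp by (intro measure_pmf.finite_measure_mono) (auto simp: not_le intro: less_imp_le)
  also have "\<dots> \<le> ?P (\<Union>j\<in>Jlow N q. ?H j) + ?P (\<Union>k. ?D k)"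
    by (rule measure_Un_le) auto
  also have "\<dots> \<le> (\<Sum>j\<in>Jlow N q. ?P (?H j)) + (\<Sum>k\<in>UNIV. ?P (?D k))"
    by (intro add_mono measure_pmf.finite_measure_subadditive_finite) auto
  also have "\<dots> \<le> (\<Sum>j\<in>Jlow N q. 1 / ?p\<^sup>2) + (\<Sum>k\<in>(UNIV :: 'k set). 2 * (\<epsilon> / real CARD('k)))"
    by (intro add_mono sum_mono H D)
  also have "\<dots> \<le> (\<Sum>j\<in>(UNIV :: 'p set). 1 / ?p\<^sup>2) + 2 * \<epsilon>"
    by (intro add_mono sum_mono2) auto
  also have "\<dots> = 1 / ?p + 2 * \<epsilon>"
    by (simp add: power2_eq_square)
  finally have "?P (- ?G) \<le> 1 / ?p + 2 * \<epsilon>" .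
  then show ?thesis
    using measure_pmf.prob_compl[of ?G ?mn] by (simp add: Compl_eq_Diff_UNIV)
qed

section \<open>The error bound with high probability\<close>

theorem theorem1:
  fixes A :: "real ^ 'k ^ 'p"
    and Tstar :: "real ^ 'k"
    and N s :: nat
    and M :: "'w measure"
    and X :: "'w \<Rightarrow> real ^ 'p"
    and That :: "'w \<Rightarrow> real ^ 'k"
    and \<epsilon> :: real
  assumes "CARD('k) < CARD('p)" and "N \<ge> 1"
    and "\<And>k. column k A \<in> prob_simplex"
    and "prob_space M" and "X \<in> borel_measurable M"
    and "distr M borel (\<lambda>\<omega>. real N *\<^sub>R X \<omega>) = multinomial N (A *v Tstar)"
    and "\<And>\<omega>. \<omega> \<in> space M \<Longrightarrow> is_mle A (X \<omega>) (That \<omega>)"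
    and "1 \<le> s" and "s \<le> CARD('k)" and "Tstar \<in> sparse_simplex s"
    and "kappa (rows_in A (Jlow N (A *v Tstar))) s > 0"
    and "\<epsilon> \<ge> 0"
  shows "\<exists>E\<in>sets M. measure M E \<ge> 1 - 2 / real CARD('p) - 2 * \<epsilon> \<and>
    (\<forall>\<omega>\<in>E. ereal (l1norm (That \<omega> - Tstar)) \<le>
      (if \<epsilon> = 0 then \<infinity>
       else ereal (2 / (kappa (rows_in A (Jlow N (A *v Tstar))) s)\<^sup>2 *
         (sqrt (2 * rho A (A *v Tstar) * ln (real CARD('k) / \<epsilon>) / real N)
          + 2 * rho A (A *v Tstar) * ln (real CARD('k) / \<epsilon>) / real N))))"
proof -
  interpret M: prob_space M by fact
  define q where "q = A *v Tstar"
  define t where "t = ln (real CARD('k) / \<epsilon>)"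
  have T: "Tstar \<in> prob_simplex" and card: "card (supp Tstar) \<le> s"
    using assms(10) by (auto simp: sparse_simplex_def)
  have q: "q \<in> prob_simplex"
    unfolding q_def by (rule stochastic_image_simplex[OF assms(3) T])
  have N: "0 < N" using assms(2) by simp
  consider "\<epsilon> = 0" | "1 / 2 \<le> \<epsilon>" | "0 < \<epsilon>" "\<epsilon> < 1 / 2"
    using assms(12) by linarith
  then show ?thesis
  proof cases
    case 1
    then show ?thesis
      by (intro bexI[of _ "space M"]) (auto simp: M.prob_space)
  next
    case 2
    (* The claimed probability is nonpositive, so the empty event serves; for \<epsilon> > K the logarithm
       in the bound is negative. *)
    moreover have "0 \<le> 2 / real CARD('p)" by simp
    ultimately have "1 - 2 / real CARD('p) - 2 * \<epsilon> \<le> 0" by linarith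
    then show ?thesis
      by (intro bexI[of _ "{}"]) auto
  next
    case 3
    let ?\<eta> = "sqrt (2 * rho A q * t / N) + rho A q * t / N"
    let ?\<delta> = "sqrt (2 * rho A q * t / N) + 2 * rho A q * t / N"
    (* A set of count vectors, not of samples: the law of N X is what the hypothesis provides. The
       event is expressed through X alone because the estimator need not be measurable. *)
    define B where "B = {y :: real ^ 'p. (\<forall>j. 0 \<le> y $ j) \<and> (\<forall>j\<in>{j. q $ j = 0}. y $ j = 0) \<and>
      (\<forall>j\<in>Jlow N q. real N * q $ j / 2 \<le> y $ j) \<and>
      (\<forall>k. \<bar>\<Sum>j\<in>UNIV. (y $ j / N - q $ j) * (A $ j $ k / q $ j)\<bar> \<le> ?\<eta>)}"
    define E where "E = (\<lambda>\<omega>. real N *\<^sub>R X \<omega>) -` B \<inter> space M"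
    have B: "B \<in> sets borel"
    proof (rule borel_closed)
      have guarded: "closed {y :: real ^ 'p. P \<longrightarrow> R y}" if "closed {y. R y}" for P R
        using that by (cases P) auto
      show "closed B"
        unfolding B_def Ball_def
        by (intro closed_Collect_conj closed_Collect_all guarded closed_Collect_le
            closed_Collect_eq continuous_intros) (use N in simp_all)
    qed
    have Xm: "(\<lambda>\<omega>. real N *\<^sub>R X \<omega>) \<in> borel_measurable M"
      using assms(5) by measurable
    have Em: "E \<in> sets M"
      unfolding E_def by (rule measurable_sets[OF Xm B])
    have dom: "A $ j \<noteq> 0" if "q $ j \<noteq> 0" for j
      using that by (auto simp: q_def matrix_vector_mul_component)
    have "1 \<le> real CARD('k)" by simp
    then have \<epsilon>K: "\<epsilon> \<le> real CARD('k)" using 3 by linarith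
    have "1 - 2 / real CARD('p) - 2 * \<epsilon> \<le> 1 - 1 / real CARD('p) - 2 * \<epsilon>"
      by (simp add: divide_right_mono)
    also have "\<dots> \<le> measure_pmf.prob (multinomial_pmf N q) {c. (\<chi> j. real (c j)) \<in> B}"
      using multinomial_regular_event[OF assms(3) q dom N 3(1) \<epsilon>K]
      by (simp add: B_def t_def)
    also have "\<dots> = measure (multinomial N q) B"
      unfolding multinomial_def by (subst measure_distr) (auto simp: B vimage_def)
    also have "\<dots> = measure M E"
      unfolding q_def assms(6)[symmetric] E_def by (rule measure_distr[OF Xm B])
    finally have prob: "1 - 2 / real CARD('p) - 2 * \<epsilon> \<le> measure M E" .
    have t0: "0 \<le> t" using 3 \<epsilon>K by (simp add: t_def ln_ge_zero)
    have \<delta>: "?\<eta> \<le> ?\<delta>"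
      using column_ratio_bounds(1)[OF assms(3) q dom] t0 by (simp add: divide_right_mono)
    have "l1norm (That \<omega> - Tstar) \<le> 2 / (kappa (rows_in A (Jlow N q)) s)\<^sup>2 * ?\<delta>"
      if "\<omega> \<in> E" for \<omega>
    proof -
      have \<omega>: "\<omega> \<in> space M" and XB: "real N *\<^sub>R X \<omega> \<in> B"
        using that by (auto simp: E_def)
      have x0: "0 \<le> X \<omega> $ j" for j
        using XB N by (simp add: B_def zero_le_mult_iff)
      have supp: "X \<omega> $ j = 0" if "q $ j = 0" for j
        using XB N that by (simp add: B_def)
      have half: "0 < q $ j \<and> q $ j / 2 \<le> X \<omega> $ j" if "j \<in> Jlow N q" for j
        using XB N that Jlow_expected_count(1)[OF N q that] by (auto simp: B_def)
      have dev: "\<bar>\<Sum>j\<in>UNIV. (X \<omega> $ j - q $ j) * (A $ j $ k / q $ j)\<bar> \<le> ?\<delta>" for k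
        using XB N \<delta> by (auto simp: B_def intro: order_trans)
      show ?thesis
        using mle_l1_error_of_regular_sample[OF assms(3) T card assms(7)[OF \<omega>] x0 _ _ _ assms(11)]
          supp half dev unfolding q_def by blast
    qed
    then show ?thesis
      using Em prob 3 by (intro bexI[of _ E]) (auto simp: q_def t_def)
  qed
qed

end
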